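(* Let $f(x)=a_nx^n+\dots+a_1x+a_0$ be a polynomial of degree $n\ge 1$ with real coefficients $a_0,\dots,a_n\in\mathbb{R}$, $a_n\neq 0$, and $a_0>0$. For $1\le k\le n$ and each sign $\pm$, let $D_k^\pm(f)$ be the determinant of the $k\times k$ matrix whose $(i,j)$ entry ($1\le i,j\le k$) is \[ d_{ij}=a_{j-i}\pm a_{i+j+n-k-1}, \] with the convention $a_m=0$ for $m<0$ and $m>n$. Then: 1. $f$ is expansive if and only if $D_k^+(f)>0$ and $D_k^-(f)>0$ for all $1\le k\le n$. 2. $f$ is expansive if and only if $D_k^+(f)>0$ and $D_k^-(f)>0$ for all $1\le k\le n-1$, and $f(1)>0$ and $f(-1)>0$. 3. Moreover, $f$ is expansive if and only if $D_k^+(f)>0$ and $D_k^-(f)>0$ for all $k\in\{n,n-2,n-4,\dots\}$ with $k\ge 1$; and $f$ is expansive if and only if $D_k^+(f)>0$ and $D_k^-(f)>0$ for all $k\in\{n-1,n-3,n-5,\dots\}$ with $k\ge1$, together with $f(1)>0$ and $f(-1)>0$.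
   Context: A polynomial is called expansive if all of its complex roots $\alpha$ satisfy $|\alpha|>1$. *)

theory Defs
  imports Complex_Main "Jordan_Normal_Form.Determinant"
begin

definition expansive :: "real poly \<Rightarrow> bool" where
  "expansive f \<longleftrightarrow>
     (\<forall>\<alpha>::complex. poly (map_poly complex_of_real f) \<alpha> = 0 \<longrightarrow> cmod \<alpha> > 1)"

(* For m > degree f the coefficient is already 0 in the library. *)
definition icoeff :: "real poly \<Rightarrow> int \<Rightarrow> real" where
  "icoeff f m = (if m < 0 then 0 else coeff f (nat m))"

definition d_entry :: "real \<Rightarrow> real poly \<Rightarrow> nat \<Rightarrow> nat \<Rightarrow> nat \<Rightarrow> real" where
  "d_entry s f k i j =
     icoeff f (int j - int i) +
     s * icoeff f (int i + int j + int (degree f) - int k - 1)"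

(* The rows and columns of a library matrix are counted from 0,
   those of d_entry from 1, hence the shift by one. *)
definition D_mat :: "real \<Rightarrow> real poly \<Rightarrow> nat \<Rightarrow> real mat" where
  "D_mat s f k = mat k k (\<lambda>(i, j). d_entry s f k (i + 1) (j + 1))"

definition D_plus :: "nat \<Rightarrow> real poly \<Rightarrow> real" where
  "D_plus k f = det (D_mat 1 f k)"

definition D_minus :: "nat \<Rightarrow> real poly \<Rightarrow> real" where
  "D_minus k f = det (D_mat (-1) f k)"

end

theory Submission
  imports Defs "Jordan_Normal_Form.Char_Poly"
begin

text \<open>
  Treat \<open>f\<close> as a polynomial of formal degree \<open>n\<close>, let \<open>f\<^sup>*(x) = x\<^sup>n f(1/x)\<close> and take the
  Schur transform \<open>g = a\<^sub>0 f - a\<^sub>n f\<^sup>*\<close>, of formal degree \<open>n - 1\<close>. If \<open>|a\<^sub>n| < |a\<^sub>0|\<close>, then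
  \<open>f\<close> is expansive iff \<open>g\<close> is, because \<open>|f\<^sup>*| \<le> |f|\<close> on the closed unit disc for expansive \<open>f\<close>.
  The matrix of \<open>D\<^sub>k\<^sup>\<plusminus>(f)\<close> is \<open>T(f) \<plusminus> T(f\<^sup>*) J\<close>, where \<open>T(f)\<close> is the upper triangular
  Toeplitz matrix of the coefficients and \<open>J\<close> the exchange matrix. As \<open>J\<^sup>2 = I\<close>, the same matrix
  for \<open>g\<close> is that of \<open>f\<close> times \<open>a\<^sub>0 I \<minusplus> a\<^sub>n J\<close>; its last row is \<open>(0, \<dots>, 0, g(0))\<close>. Hence
  \<open>D\<^sub>k\<^sup>\<plusminus>(f)\<close> and \<open>D\<^bsub>k-1\<^esub>\<^sup>\<plusminus>(g)\<close>, the latter with formal degree \<open>n - 1\<close>, have the same sign, and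
  induction on \<open>n\<close> applies. The condition \<open>|a\<^sub>n| < a\<^sub>0\<close> follows from \<open>D\<^sub>1\<^sup>\<plusminus> > 0\<close> as well as from
  \<open>D\<^sub>2\<^sup>\<plusminus> > 0\<close>, which is why every second \<open>k\<close> suffices.
\<close>

section \<open>Reciprocal polynomials and the Schur transform\<close>

definition reciprocal_poly :: "nat \<Rightarrow> 'a::comm_semiring_1 poly \<Rightarrow> 'a poly" where
  "reciprocal_poly n f = monom 1 (n - degree f) * reflect_poly f"

lemma coeff_reciprocal_poly:
  assumes "degree f \<le> n"
  shows "coeff (reciprocal_poly n f) i = (if i \<le> n then coeff f (n - i) else 0)"
  using assms by (auto simp: reciprocal_poly_def coeff_monom_mult coeff_reflect_poly
      intro!: arg_cong[where f = "coeff f"] coeff_eq_0)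

lemma reciprocal_poly_Suc:
  assumes "degree f \<le> n"
  shows "reciprocal_poly (Suc n) f = pCons 0 (reciprocal_poly n f)"
  using assms by (simp add: reciprocal_poly_def Suc_diff_le monom_Suc)

lemma poly_reciprocal_poly_square_eq_1:
  fixes f :: "'a::field poly"
  assumes "degree f \<le> n" and "s * s = 1"
  shows "poly (reciprocal_poly n f) s = s ^ n * poly f s"
proof -
  have "s \<noteq> 0" and "inverse s = s"
    using assms(2) by (auto intro: inverse_unique)
  then have "poly (reciprocal_poly n f) s = s ^ (n - degree f) * (s ^ degree f * poly f s)"
    by (simp add: reciprocal_poly_def poly_monom poly_reflect_poly_nz)
  also have "\<dots> = s ^ n * poly f s"
    using assms(1) by (simp flip: mult.assoc power_add)
  finally show ?thesis .
qed

definition schur_transform :: "nat \<Rightarrow> 'a::comm_ring_1 poly \<Rightarrow> 'a poly" where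
  "schur_transform n f = smult (coeff f 0) f - smult (coeff f n) (reciprocal_poly n f)"

lemma coeff_schur_transform:
  assumes "degree f \<le> n"
  shows "coeff (schur_transform n f) i
       = coeff f 0 * coeff f i - coeff f n * (if i \<le> n then coeff f (n - i) else 0)"
  using assms by (simp add: schur_transform_def coeff_reciprocal_poly)

lemma coeff_0_schur_transform:
  assumes "degree f \<le> n"
  shows "coeff (schur_transform n f) 0 = (coeff f 0)\<^sup>2 - (coeff f n)\<^sup>2"
  using assms by (simp add: coeff_schur_transform power2_eq_square)

lemma degree_schur_transform:
  assumes "degree f \<le> n"
  shows "degree (schur_transform n f) \<le> n - 1"
proof (rule degree_le, intro allI impI)
  fix i assume "n - 1 < i"
  then have "i = n \<or> i > n"
    by linarith
  then show "coeff (schur_transform n f) i = 0"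
    using assms by (auto simp: coeff_schur_transform coeff_eq_0)
qed

lemma reciprocal_poly_schur_transform:
  assumes "degree f \<le> n"
  shows "reciprocal_poly n (schur_transform n f)
       = smult (coeff f 0) (reciprocal_poly n f) - smult (coeff f n) f"
proof (rule poly_eqI)
  fix i
  have "degree (schur_transform n f) \<le> n"
    using degree_schur_transform[OF assms] by linarith
  then show "coeff (reciprocal_poly n (schur_transform n f)) i
      = coeff (smult (coeff f 0) (reciprocal_poly n f) - smult (coeff f n) f) i"
    using assms by (simp add: coeff_reciprocal_poly coeff_schur_transform coeff_eq_0)
qed

lemma schur_transform_inversion:
  assumes "degree f \<le> n"
  shows "smult (coeff f 0) (schur_transform n f)
           + smult (coeff f n) (reciprocal_poly n (schur_transform n f))
       = smult ((coeff f 0)\<^sup>2 - (coeff f n)\<^sup>2) f"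
  unfolding reciprocal_poly_schur_transform[OF assms] unfolding schur_transform_def
  by (simp add: smult_diff_right smult_diff_left power2_eq_square mult.commute)

lemma coeff_0_schur_transform_pos:
  fixes f :: "'a::linordered_idom poly"
  assumes "degree f \<le> n" and "\<bar>coeff f n\<bar> < \<bar>coeff f 0\<bar>"
  shows "0 < coeff (schur_transform n f) 0"
  using assms abs_le_square_iff[of "coeff f 0" "coeff f n"]
  by (simp add: coeff_0_schur_transform not_le[symmetric])

lemma poly_schur_transform_pos_iff:
  fixes f :: "'a::linordered_field poly"
  assumes "degree f \<le> n" and "\<bar>coeff f n\<bar> < coeff f 0" and "\<bar>s\<bar> = 1"
  shows "0 < poly (schur_transform n f) s \<longleftrightarrow> 0 < poly f s"
proof -
  have "s * s = 1"
    using assms(3) by (simp add: abs_mult_self_eq[symmetric, of s])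
  then have "poly (schur_transform n f) s = (coeff f 0 - coeff f n * s ^ n) * poly f s"
    by (simp add: schur_transform_def poly_reciprocal_poly_square_eq_1[OF assms(1)]
        left_diff_distrib)
  moreover have "\<bar>coeff f n * s ^ n\<bar> = \<bar>coeff f n\<bar>"
    using assms(3) by (simp add: abs_mult power_abs)
  then have "0 < coeff f 0 - coeff f n * s ^ n"
    using assms(2) abs_ge_self[of "coeff f n * s ^ n"] by linarith
  ultimately show ?thesis
    by (simp add: zero_less_mult_iff)
qed

section \<open>Polynomials without roots in the closed unit disc\<close>

lemma cmod_reflect_linear_le:
  assumes "cmod z \<le> 1" and "1 < cmod \<alpha>"
  shows "cmod (1 - \<alpha> * z) \<le> cmod (cnj z - \<alpha>)"
proof -
  have "(cmod (cnj z - \<alpha>))\<^sup>2 - (cmod (1 - \<alpha> * z))\<^sup>2 = ((cmod \<alpha>)\<^sup>2 - 1) * (1 - (cmod z)\<^sup>2)"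
    unfolding cmod_power2 by (simp add: power2_eq_square algebra_simps)
  also have "\<dots> \<ge> 0"
    using assms by (intro mult_nonneg_nonneg) (auto simp: abs_square_le_1)
  finally have "(cmod (1 - \<alpha> * z))\<^sup>2 \<le> (cmod (cnj z - \<alpha>))\<^sup>2"
    by linarith
  then show ?thesis
    by (rule power2_le_imp_le) simp
qed

text \<open>Evaluating \<open>p\<close> at \<open>cnj z\<close> avoids conjugating the coefficients of the reciprocal.\<close>

lemma cmod_reflect_poly_le:
  fixes p :: "complex poly"
  assumes "\<And>\<alpha>. poly p \<alpha> = 0 \<Longrightarrow> 1 < cmod \<alpha>" and z: "cmod z \<le> 1"
  shows "cmod (poly (reflect_poly p) z) \<le> cmod (poly p (cnj z))"
proof -
  obtain \<alpha>s where p: "p = smult (lead_coeff p) (\<Prod>\<alpha>\<leftarrow>\<alpha>s. [:- \<alpha>, 1:])"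
    using fundamental_theorem_algebra_factorized[of p] by metis
  have "poly p \<alpha> = 0" if "\<alpha> \<in> set \<alpha>s" for \<alpha>
    using that by (subst p) (simp add: linear_poly_root)
  then have "1 < cmod \<alpha>" if "\<alpha> \<in> set \<alpha>s" for \<alpha>
    using that assms(1) by blast
  then have "cmod (poly (reflect_poly (\<Prod>\<alpha>\<leftarrow>\<alpha>s. [:- \<alpha>, 1:])) z)
      \<le> cmod (poly (\<Prod>\<alpha>\<leftarrow>\<alpha>s. [:- \<alpha>, 1:]) (cnj z))"
  proof (induction \<alpha>s)
    case (Cons \<alpha> \<alpha>s)
    have "reflect_poly [:- \<alpha>, 1:] = [:1, - \<alpha>:]"
      by (simp add: reflect_poly_def cCons_def)
    moreover have "cmod (1 - \<alpha> * z) \<le> cmod (cnj z - \<alpha>)"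
      using Cons.prems z by (intro cmod_reflect_linear_le) auto
    moreover have "cmod (poly (reflect_poly (\<Prod>\<alpha>\<leftarrow>\<alpha>s. [:- \<alpha>, 1:])) z)
        \<le> cmod (poly (\<Prod>\<alpha>\<leftarrow>\<alpha>s. [:- \<alpha>, 1:]) (cnj z))"
      using Cons by simp
    ultimately show ?case
      unfolding list.map prod_list.Cons reflect_poly_mult poly_mult norm_mult
      by (intro mult_mono) (simp_all add: mult.commute[of z])
  qed simp
  then show ?thesis
    by (subst (1 2) p) (simp add: reflect_poly_smult norm_mult mult_left_mono)
qed

lemma cmod_lead_coeff_less:
  fixes p :: "complex poly"
  assumes roots: "\<And>\<alpha>. poly p \<alpha> = 0 \<Longrightarrow> 1 < cmod \<alpha>" and "0 < degree p"
  shows "cmod (lead_coeff p) < cmod (coeff p 0)"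
proof -
  obtain \<alpha> where root: "poly p \<alpha> = 0"
    using assms(2) alg_closed_imp_poly_has_root by blast
  then obtain q where p: "p = [:- \<alpha>, 1:] * q"
    by (auto simp: poly_eq_0_iff_dvd elim: dvdE)
  have q_roots: "1 < cmod \<beta>" if "poly q \<beta> = 0" for \<beta>
    using roots[of \<beta>] that p by simp
  have "lead_coeff p = lead_coeff q"
    unfolding p lead_coeff_mult by simp
  then have "cmod (lead_coeff p) \<le> cmod (coeff q 0)"
    using cmod_reflect_poly_le[of q 0, OF q_roots] by (simp add: poly_0_coeff_0)
  also have "coeff q 0 \<noteq> 0"
    using q_roots[of 0] by (auto simp: poly_0_coeff_0)
  then have "cmod (coeff q 0) < cmod \<alpha> * cmod (coeff q 0)"
    using roots[OF root] by simp
  also have "\<dots> = cmod (coeff p 0)"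
    unfolding p by (simp add: norm_mult)
  finally show ?thesis .
qed

section \<open>Expansive polynomials\<close>

abbreviation cpoly :: "real poly \<Rightarrow> complex poly" where
  "cpoly \<equiv> map_poly complex_of_real"

lemma expansive_iff_nonzero_on_disc:
  "expansive f \<longleftrightarrow> (\<forall>z. cmod z \<le> 1 \<longrightarrow> poly (cpoly f) z \<noteq> 0)"
  unfolding expansive_def by (meson not_le)

lemma expansive_smult_iff: "c \<noteq> 0 \<Longrightarrow> expansive (smult c f) \<longleftrightarrow> expansive f"
  by (simp add: expansive_def of_real_hom.map_poly_hom_smult)

lemma cpoly_reciprocal_poly: "cpoly (reciprocal_poly n f) = reciprocal_poly n (cpoly f)"
  by (simp add: poly_eq_iff reciprocal_poly_def coeff_monom_mult coeff_reflect_poly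
      degree_map_poly)

lemma cmod_reciprocal_poly_le_if_expansive:
  assumes "expansive f" and "cmod z \<le> 1"
  shows "cmod (poly (cpoly (reciprocal_poly n f)) z) \<le> cmod (poly (cpoly f) z)"
proof -
  let ?m = "n - degree f"
  have "cmod (poly (cpoly (reciprocal_poly n f)) z)
      = cmod z ^ ?m * cmod (poly (reflect_poly (cpoly f)) z)"
    unfolding cpoly_reciprocal_poly
    by (simp add: reciprocal_poly_def norm_mult norm_power poly_monom degree_map_poly)
  also have "\<dots> \<le> cmod (poly (reflect_poly (cpoly f)) z)"
    using assms(2) by (intro mult_left_le_one_le) (auto simp: power_le_one)
  also have "\<dots> \<le> cmod (poly (cpoly f) (cnj z))"
    using assms by (intro cmod_reflect_poly_le) (auto simp: expansive_def)
  also have "\<dots> = cmod (poly (cpoly f) z)"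
    by (simp flip: poly_cnj_real)
  finally show ?thesis .
qed

lemma abs_coeff_less_if_expansive:
  assumes "expansive f" and "degree f \<le> n" and "0 < n"
  shows "\<bar>coeff f n\<bar> < \<bar>coeff f 0\<bar>"
proof (cases "degree f = n")
  case True
  then show ?thesis
    using assms cmod_lead_coeff_less[of "cpoly f"] by (simp add: expansive_def degree_map_poly)
next
  case False
  moreover have "coeff f 0 \<noteq> 0"
    using assms(1) by (auto simp: expansive_def poly_0_coeff_0 dest: spec[of _ 0])
  ultimately show ?thesis
    using assms(2) by (simp add: coeff_eq_0)
qed

text \<open>A Rouche-type perturbation: the first summand dominates the second on the unit disc.\<close>

lemma expansive_add_reciprocal_poly:
  assumes "expansive f" and "\<bar>b\<bar> < \<bar>a\<bar>"
  shows "expansive (smult a f + smult b (reciprocal_poly n f))"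
  unfolding expansive_iff_nonzero_on_disc
proof (intro allI impI)
  fix z assume z: "cmod z \<le> 1"
  let ?F = "poly (cpoly f) z" and ?R = "poly (cpoly (reciprocal_poly n f)) z"
  have "?F \<noteq> 0"
    using assms(1) z unfolding expansive_iff_nonzero_on_disc by blast
  have "cmod (of_real b * ?R) \<le> \<bar>b\<bar> * cmod ?F"
    using cmod_reciprocal_poly_le_if_expansive[OF assms(1) z]
    by (simp add: norm_mult mult_left_mono)
  also have "\<dots> < \<bar>a\<bar> * cmod ?F"
    using assms(2) \<open>?F \<noteq> 0\<close> by simp
  also have "\<dots> = cmod (of_real a * ?F)"
    by (simp add: norm_mult)
  finally have "of_real a * ?F + of_real b * ?R \<noteq> 0"
    by (metis add_eq_0_iff norm_minus_cancel less_irrefl)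
  then show "poly (cpoly (smult a f + smult b (reciprocal_poly n f))) z \<noteq> 0"
    by (simp add: of_real_hom.map_poly_hom_add of_real_hom.map_poly_hom_smult)
qed

lemma expansive_schur_transform_iff:
  assumes "degree f \<le> n" and "\<bar>coeff f n\<bar> < \<bar>coeff f 0\<bar>"
  shows "expansive (schur_transform n f) \<longleftrightarrow> expansive f"
proof
  assume "expansive f"
  from expansive_add_reciprocal_poly[OF this, of "- coeff f n" "coeff f 0" n]
  show "expansive (schur_transform n f)"
    using assms(2) by (simp add: schur_transform_def)
next
  assume "expansive (schur_transform n f)"
  from expansive_add_reciprocal_poly[OF this assms(2), of n]
  have "expansive (smult ((coeff f 0)\<^sup>2 - (coeff f n)\<^sup>2) f)"
    by (simp add: schur_transform_inversion[OF assms(1)])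
  moreover have "(coeff f 0)\<^sup>2 - (coeff f n)\<^sup>2 \<noteq> 0"
    using coeff_0_schur_transform_pos[OF assms] by (simp add: coeff_0_schur_transform[OF assms(1)])
  ultimately show "expansive f"
    by (simp add: expansive_smult_iff)
qed

lemma degree_le_1_conv_pCons: "degree p \<le> 1 \<Longrightarrow> p = [:coeff p 0, coeff p 1:]"
  by (auto simp: poly_eq_iff coeff_pCons coeff_eq_0 split: nat.split)

lemma expansive_if_degree_le_1:
  assumes "degree f \<le> 1" and "\<bar>coeff f 1\<bar> < \<bar>coeff f 0\<bar>"
  shows "expansive f"
  unfolding expansive_def
proof (intro allI impI)
  fix z assume "poly (cpoly f) z = 0"
  then have "of_real (coeff f 0) = - (z * of_real (coeff f 1))"
    by (subst (asm) degree_le_1_conv_pCons[OF assms(1)])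
      (simp add: of_real_hom.map_poly_pCons_hom add_eq_0_iff2)
  then have "\<bar>coeff f 0\<bar> = cmod z * \<bar>coeff f 1\<bar>"
    by (metis norm_minus_cancel norm_mult norm_of_real)
  then show "1 < cmod z"
    using assms(2) mult_left_le_one_le[of "\<bar>coeff f 1\<bar>" "cmod z"] by fastforce
qed

lemma poly_pos_if_expansive:
  assumes "expansive f" and "0 < coeff f 0" and "\<bar>x\<bar> \<le> 1"
  shows "0 < poly f x"
proof (rule ccontr)
  have nonzero: "poly f y \<noteq> 0" if "\<bar>y\<bar> \<le> 1" for y
    using assms(1) that unfolding expansive_iff_nonzero_on_disc
    by (metis norm_of_real of_real_0 of_real_hom.poly_map_poly)
  assume "\<not> 0 < poly f x"
  then have "poly f x < 0"
    using nonzero[OF assms(3)] by linarith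
  moreover have "0 < poly f 0"
    using assms(2) by (simp add: poly_0_coeff_0)
  ultimately obtain y where "\<bar>y\<bar> \<le> 1" "poly f y = 0"
    using assms(3) poly_IVT_neg[of 0 x f] poly_IVT_pos[of x 0 f]
    by (cases x "0::real" rule: linorder_cases) force+
  then show False
    using nonzero by blast
qed

section \<open>Exchange matrices\<close>

definition exchange_mat :: "nat \<Rightarrow> 'a::semiring_1 mat" where
  "exchange_mat k = mat k k (\<lambda>(i, j). if i + j + 1 = k then 1 else 0)"

lemma exchange_mat_carrier [simp]: "exchange_mat k \<in> carrier_mat k k"
  by (simp add: exchange_mat_def)

lemmas exchange_mat_dim [simp] = carrier_matD[OF exchange_mat_carrier]

lemma index_mult_exchange_mat:
  assumes "A \<in> carrier_mat m k" and "i < m" and "j < k"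
  shows "(A * exchange_mat k) $$ (i, j) = A $$ (i, k - 1 - j)"
proof -
  have "(A * exchange_mat k) $$ (i, j) = (\<Sum>l<k. A $$ (i, l) * (if l = k - 1 - j then 1 else 0))"
    using assms
    by (auto simp: exchange_mat_def scalar_prod_def atLeast0LessThan intro!: sum.cong)
  also have "\<dots> = A $$ (i, k - 1 - j)"
    using assms by (simp add: if_distrib cong: if_cong)
  finally show ?thesis .
qed

definition cross_mat :: "nat \<Rightarrow> 'a::comm_ring_1 \<Rightarrow> 'a \<Rightarrow> 'a mat" where
  "cross_mat k a b = a \<cdot>\<^sub>m 1\<^sub>m k + b \<cdot>\<^sub>m exchange_mat k"

lemma cross_mat_carrier [simp]: "cross_mat k a b \<in> carrier_mat k k"
  by (simp add: cross_mat_def)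

lemmas cross_mat_dim [simp] = carrier_matD[OF cross_mat_carrier]

lemma index_cross_mat:
  assumes "i < k" and "j < k"
  shows "cross_mat k a b $$ (i, j) = (if i = j then a else 0) + (if i + j + 1 = k then b else 0)"
  using assms by (simp add: cross_mat_def exchange_mat_def)

lemma mult_cross_mat:
  assumes "A \<in> carrier_mat m k"
  shows "A * cross_mat k a b = a \<cdot>\<^sub>m A + b \<cdot>\<^sub>m (A * exchange_mat k)"
  unfolding cross_mat_def using assms
  by (simp add: mult_add_distrib_mat[of _ m k _ k] mult_smult_distrib[of _ m k _ k])

lemma cross_mat_mult:
  "cross_mat k a b * cross_mat k c d = cross_mat k (a * c + b * d) (a * d + b * c)"
  by (rule eq_matI)
    (auto simp: mult_cross_mat[OF cross_mat_carrier] index_mult_exchange_mat[OF cross_mat_carrier]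
      index_cross_mat algebra_simps simp del: index_mult_mat(1))

lemma det_cross_mat_mult:
  "det (cross_mat k a b) * det (cross_mat k c d)
   = det (cross_mat k (a * c + b * d) (a * d + b * c))"
  by (simp add: det_mult[OF cross_mat_carrier cross_mat_carrier] flip: cross_mat_mult)

lemma det_cross_mat_0: "det (cross_mat k a 0) = a ^ k"
proof -
  have "cross_mat k a 0 = a \<cdot>\<^sub>m 1\<^sub>m k"
    by (rule eq_matI) (auto simp: cross_mat_def exchange_mat_def)
  then show ?thesis
    by simp
qed

text \<open>
  The determinant is nonzero because \<open>(a I + b J)(a I - b J) = (a\<^sup>2 - b\<^sup>2) I\<close>, and nonnegative
  because \<open>a I + b J\<close> is the square of some \<open>x I + y J\<close>: take \<open>x \<plusminus> y\<close> to be the square roots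
  of \<open>a \<plusminus> b\<close>.
\<close>

lemma det_cross_mat_pos:
  fixes a b :: real
  assumes "\<bar>b\<bar> < a"
  shows "0 < det (cross_mat k a b)"
proof -
  define x where "x = (sqrt (a + b) + sqrt (a - b)) / 2"
  define y where "y = (sqrt (a + b) - sqrt (a - b)) / 2"
  have "sqrt (a + b) * sqrt (a + b) = a + b" "sqrt (a - b) * sqrt (a - b) = a - b"
    using assms by auto
  then have "x * x + y * y = a" "x * y + y * x = b"
    by (simp_all add: x_def y_def field_simps)
  then have "det (cross_mat k a b) = det (cross_mat k x y) * det (cross_mat k x y)"
    by (simp add: det_cross_mat_mult)
  then have "0 \<le> det (cross_mat k a b)"
    by simp
  moreover have "det (cross_mat k a b) * det (cross_mat k a (- b)) = ((a - b) * (a + b)) ^ k"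
    by (simp add: det_cross_mat_mult det_cross_mat_0 algebra_simps)
  then have "det (cross_mat k a b) \<noteq> 0"
    using assms by auto
  ultimately show ?thesis
    by simp
qed

section \<open>Schur--Cohn matrices\<close>

definition upper_toeplitz_mat :: "nat \<Rightarrow> 'a::zero poly \<Rightarrow> 'a mat" where
  "upper_toeplitz_mat k f = mat k k (\<lambda>(i, j). if i \<le> j then coeff f (j - i) else 0)"

lemma upper_toeplitz_mat_carrier [simp]: "upper_toeplitz_mat k f \<in> carrier_mat k k"
  by (simp add: upper_toeplitz_mat_def)

lemmas upper_toeplitz_mat_dim [simp] = carrier_matD[OF upper_toeplitz_mat_carrier]

definition schur_cohn_mat :: "'a::comm_ring_1 \<Rightarrow> 'a poly \<Rightarrow> nat \<Rightarrow> nat \<Rightarrow> 'a mat" where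
  "schur_cohn_mat s f n k = upper_toeplitz_mat k f
     + s \<cdot>\<^sub>m (upper_toeplitz_mat k (reciprocal_poly n f) * exchange_mat k)"

lemma schur_cohn_mat_carrier [simp]: "schur_cohn_mat s f n k \<in> carrier_mat k k"
  by (simp add: schur_cohn_mat_def mult_carrier_mat[of _ k k])

lemmas schur_cohn_mat_dim [simp] = carrier_matD[OF schur_cohn_mat_carrier]

lemma index_schur_cohn_mat:
  assumes "i < k" and "j < k"
  shows "schur_cohn_mat s f n k $$ (i, j) = (if i \<le> j then coeff f (j - i) else 0)
    + s * (if i + j < k then coeff (reciprocal_poly n f) (k - 1 - j - i) else 0)"
  using assms
  by (simp add: schur_cohn_mat_def index_mult_exchange_mat[OF upper_toeplitz_mat_carrier]
      del: index_mult_mat(1)) (auto simp: upper_toeplitz_mat_def)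

lemma D_mat_eq_schur_cohn_mat: "D_mat s f k = schur_cohn_mat s f (degree f) k"
proof (rule eq_matI)
  fix i j assume "i < dim_row (schur_cohn_mat s f (degree f) k)"
    and "j < dim_col (schur_cohn_mat s f (degree f) k)"
  then have ij: "i < k" "j < k"
    by simp_all
  have "icoeff f (int j - int i) = (if i \<le> j then coeff f (j - i) else 0)"
    by (auto simp: icoeff_def nat_diff_distrib)
  moreover have "icoeff f (int i + int j + int (degree f) + 1 - int k)
      = (if i + j < k then coeff (reciprocal_poly (degree f) f) (k - 1 - j - i) else 0)"
  proof (cases "i + j < k")
    case True
    then have "nat (int i + int j + int (degree f) + 1 - int k) = degree f - (k - 1 - j - i)"
      and "int i + int j + int (degree f) + 1 - int k < 0 \<longleftrightarrow> degree f < k - 1 - j - i"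
      by linarith+
    then show ?thesis
      using True by (simp add: icoeff_def coeff_reciprocal_poly not_less del: diff_diff_left)
  next
    case False
    then have "degree f < nat (int i + int j + int (degree f) + 1 - int k)"
      by simp
    then show ?thesis
      using False by (simp add: icoeff_def coeff_eq_0)
  qed
  ultimately show "D_mat s f k $$ (i, j) = schur_cohn_mat s f (degree f) k $$ (i, j)"
    using ij by (simp add: index_schur_cohn_mat D_mat_def d_entry_def algebra_simps)
qed (simp_all add: D_mat_def)

lemma schur_cohn_mat_schur_transform:
  assumes "s * s = 1" and "degree f \<le> n"
  shows "schur_cohn_mat s (schur_transform n f) n k
       = schur_cohn_mat s f n k * cross_mat k (coeff f 0) (- s * coeff f n)" (is "?L = ?R")
proof (rule eq_matI)
  fix i j assume "i < dim_row ?R" "j < dim_col ?R"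
  then have ij: "i < k" "j < k"
    by simp_all
  let ?a = "coeff f 0" and ?b = "coeff f n" and ?r = "reciprocal_poly n f"
  have "?L $$ (i, j) = (if i \<le> j then ?a * coeff f (j - i) - ?b * coeff ?r (j - i) else 0)
      + s * (if i + j < k then ?a * coeff ?r (k - 1 - j - i) - ?b * coeff f (k - 1 - j - i) else 0)"
    by (simp add: index_schur_cohn_mat[OF ij] reciprocal_poly_schur_transform[OF assms(2)])
      (simp add: schur_transform_def)
  also have "\<dots> = ?a * schur_cohn_mat s f n k $$ (i, j)
      + - s * ?b * schur_cohn_mat s f n k $$ (i, k - 1 - j)"
  proof -
    have cancel: "s * (s * x) = x" for x
      using assms(1) by (simp flip: mult.assoc)
    have "k - 1 - (k - 1 - j) - i = j - i" "i \<le> k - 1 - j \<longleftrightarrow> i + j < k"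
        "i + (k - 1 - j) < k \<longleftrightarrow> i \<le> j" "k - 1 - j < k"
      using ij by auto
    then show ?thesis
      using ij by (simp add: index_schur_cohn_mat cancel algebra_simps del: diff_diff_left)
  qed
  also have "\<dots> = ?R $$ (i, j)"
    using ij by (simp add: mult_cross_mat[OF schur_cohn_mat_carrier]
        index_mult_exchange_mat[OF schur_cohn_mat_carrier] del: index_mult_mat(1))
  finally show "?L $$ (i, j) = ?R $$ (i, j)" .
qed simp_all

lemma det_last_row_eq_0:
  assumes A: "A \<in> carrier_mat (Suc k) (Suc k)" and "\<And>j. j < k \<Longrightarrow> A $$ (k, j) = 0"
  shows "det A = A $$ (k, k) * det (mat_delete A k k)"
proof -
  have "det A = (\<Sum>j<Suc k. A $$ (k, j) * cofactor A k j)"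
    by (rule laplace_expansion_row[OF A]) simp
  also have "\<dots> = A $$ (k, k) * det (mat_delete A k k)"
    using assms(2) by (simp add: cofactor_def)
  finally show ?thesis .
qed

lemma mat_delete_schur_cohn_mat:
  assumes "degree f \<le> n"
  shows "mat_delete (schur_cohn_mat s f (Suc n) (Suc k)) k k = schur_cohn_mat s f n k"
    (is "?L = ?R")
proof (rule eq_matI)
  fix i j assume "i < dim_row ?R" "j < dim_col ?R"
  then have "i < k" "j < k"
    by simp_all
  moreover have "coeff (reciprocal_poly (Suc n) f) (k - j - i)
      = (if i + j < k then coeff (reciprocal_poly n f) (k - 1 - j - i) else 0)"
  proof (cases "i + j < k")
    case True
    then have "k - j - i = Suc (k - 1 - j - i)"
      by simp
    then show ?thesis
      using True by (simp add: reciprocal_poly_Suc[OF assms])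
  qed (simp add: reciprocal_poly_Suc[OF assms])
  moreover have "coeff (reciprocal_poly (Suc n) f) 0 = 0"
    by (simp add: reciprocal_poly_Suc[OF assms])
  ultimately show "?L $$ (i, j) = ?R $$ (i, j)"
    by (simp add: mat_delete_def index_schur_cohn_mat)
qed simp_all

lemma det_schur_cohn_mat_Suc:
  assumes "degree f \<le> n"
  shows "det (schur_cohn_mat s f (Suc n) (Suc k)) = coeff f 0 * det (schur_cohn_mat s f n k)"
proof -
  have "schur_cohn_mat s f (Suc n) (Suc k) $$ (k, j) = (if j = k then coeff f 0 else 0)"
    if "j \<le> k" for j
    using that by (auto simp: index_schur_cohn_mat reciprocal_poly_Suc[OF assms])
  then show ?thesis
    by (simp add: det_last_row_eq_0[OF schur_cohn_mat_carrier] mat_delete_schur_cohn_mat[OF assms])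
qed

section \<open>Positivity of the Schur--Cohn determinants\<close>

definition schur_cohn_pos :: "real poly \<Rightarrow> nat \<Rightarrow> nat \<Rightarrow> bool" where
  "schur_cohn_pos f n k \<longleftrightarrow>
     0 < det (schur_cohn_mat 1 f n k) \<and> 0 < det (schur_cohn_mat (- 1) f n k)"

lemma D_pos_iff_schur_cohn_pos:
  "0 < D_plus k f \<and> 0 < D_minus k f \<longleftrightarrow> schur_cohn_pos f (degree f) k"
  by (simp add: D_plus_def D_minus_def D_mat_eq_schur_cohn_mat schur_cohn_pos_def)

lemma schur_cohn_pos_0: "schur_cohn_pos f n 0"
  by (simp add: schur_cohn_pos_def)

lemma det_schur_cohn_mat_schur_transform_pos_iff:
  fixes s :: real
  assumes "s * s = 1" and "degree f \<le> Suc n" and "\<bar>coeff f (Suc n)\<bar> < coeff f 0"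
  shows "0 < det (schur_cohn_mat s (schur_transform (Suc n) f) n k)
     \<longleftrightarrow> 0 < det (schur_cohn_mat s f (Suc n) (Suc k))"
proof -
  let ?g = "schur_transform (Suc n) f"
  let ?C = "cross_mat (Suc k) (coeff f 0) (- s * coeff f (Suc n))"
  have "degree ?g \<le> n"
    using degree_schur_transform[OF assms(2)] by simp
  then have "coeff ?g 0 * det (schur_cohn_mat s ?g n k) = det (schur_cohn_mat s ?g (Suc n) (Suc k))"
    by (simp add: det_schur_cohn_mat_Suc)
  also have "\<dots> = det (schur_cohn_mat s f (Suc n) (Suc k)) * det ?C"
    by (simp add: schur_cohn_mat_schur_transform[OF assms(1,2)]
        det_mult[OF schur_cohn_mat_carrier cross_mat_carrier])
  finally have "coeff ?g 0 * det (schur_cohn_mat s ?g n k)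
      = det (schur_cohn_mat s f (Suc n) (Suc k)) * det ?C" .
  moreover have "\<bar>s\<bar> = 1"
    using assms(1) square_eq_1_iff[of s] by auto
  then have "0 < det ?C"
    using assms(3) by (intro det_cross_mat_pos) (simp add: abs_mult)
  moreover have "0 < coeff ?g 0"
    using assms(2,3) by (intro coeff_0_schur_transform_pos) auto
  ultimately show ?thesis
    by (metis zero_less_mult_pos zero_less_mult_pos2 mult_pos_pos)
qed

lemma schur_cohn_pos_schur_transform_iff:
  assumes "degree f \<le> Suc n" and "\<bar>coeff f (Suc n)\<bar> < coeff f 0"
  shows "schur_cohn_pos (schur_transform (Suc n) f) n k \<longleftrightarrow> schur_cohn_pos f (Suc n) (Suc k)"
  using assms by (simp add: schur_cohn_pos_def det_schur_cohn_mat_schur_transform_pos_iff)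

lemma det_schur_cohn_mat_1:
  assumes "degree f \<le> n"
  shows "det (schur_cohn_mat s f n 1) = coeff f 0 + s * coeff f n"
  using assms by (simp add: det_single index_schur_cohn_mat coeff_reciprocal_poly)

lemma det_2x2:
  assumes A: "A \<in> carrier_mat 2 2"
  shows "det A = A $$ (0, 0) * A $$ (1, 1) - A $$ (0, 1) * A $$ (1, 0)"
proof -
  have "det (mat_delete A 0 j) = mat_delete A 0 j $$ (0, 0)" for j
    using A by (intro det_single) (auto simp: mat_delete_def)
  then show ?thesis
    using A laplace_expansion_row[OF A, of 0]
    by (simp add: numeral_2_eq_2 cofactor_def) (simp add: mat_delete_def)
qed

lemma det_schur_cohn_mat_2:
  assumes "degree f \<le> Suc n"
  shows "det (schur_cohn_mat s f (Suc n) 2)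
       = (coeff f 0 + s * coeff f n) * coeff f 0
         - (coeff f 1 + s * coeff f (Suc n)) * (s * coeff f (Suc n))"
  using assms by (simp add: det_2x2 index_schur_cohn_mat coeff_reciprocal_poly)

lemma abs_coeff_less_if_schur_cohn_pos:
  assumes "degree f \<le> n" and "1 \<le> n" and "0 < coeff f 0"
    and "schur_cohn_pos f n 1 \<or> schur_cohn_pos f n 2"
  shows "\<bar>coeff f n\<bar> < coeff f 0"
  using assms(4)
proof
  assume "schur_cohn_pos f n 1"
  then show ?thesis
    unfolding schur_cohn_pos_def det_schur_cohn_mat_1[OF assms(1)] by auto
next
  assume "schur_cohn_pos f n 2"
  moreover obtain m where "n = Suc m"
    using assms(2) by (cases n) auto
  ultimately have "(coeff f n)\<^sup>2 < (coeff f 0)\<^sup>2"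
    using assms(1) unfolding schur_cohn_pos_def
    by (simp add: det_schur_cohn_mat_2 algebra_simps power2_eq_square)
  then show ?thesis
    using assms(3) abs_le_square_iff[of "coeff f 0" "coeff f n"] by linarith
qed

section \<open>Expansiveness criteria\<close>

lemma schur_cohn_pos_if_expansive:
  assumes "expansive f" and "degree f \<le> n" and "0 < coeff f 0" and "k \<le> n"
  shows "schur_cohn_pos f n k"
  using assms
proof (induction n arbitrary: f k)
  case 0
  then show ?case
    by (simp add: schur_cohn_pos_0)
next
  case (Suc n)
  let ?g = "schur_transform (Suc n) f"
  have less: "\<bar>coeff f (Suc n)\<bar> < coeff f 0"
    using Suc.prems abs_coeff_less_if_expansive[of f "Suc n"] by simp
  show ?case
  proof (cases k)
    case 0
    then show ?thesis
      by (simp add: schur_cohn_pos_0)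
  next
    case (Suc l)
    have "schur_cohn_pos ?g n l"
    proof (rule Suc.IH)
      show "expansive ?g" "0 < coeff ?g 0"
        using Suc.prems less
        by (simp_all add: expansive_schur_transform_iff coeff_0_schur_transform_pos)
      show "degree ?g \<le> n"
        using degree_schur_transform[OF Suc.prems(2)] by simp
      show "l \<le> n"
        using Suc Suc.prems(4) by simp
    qed
    then show ?thesis
      using Suc Suc.prems(2) less by (simp add: schur_cohn_pos_schur_transform_iff)
  qed
qed

text \<open>
  The witness is the \<open>n\<close>-fold Schur transform. Each step lowers the order of the determinants by
  one, so that the order \<open>1\<close> or \<open>2\<close> needed for the next step stays in the given parity class.
\<close>

lemma schur_reduction:
  assumes "degree f \<le> n + d" and "0 < coeff f 0"
    and "\<forall>k\<ge>1. (\<exists>m. n = k + 2 * m) \<longrightarrow> schur_cohn_pos f (n + d) k"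
  shows "\<exists>g. degree g \<le> d \<and> 0 < coeff g 0 \<and> (expansive g \<longleftrightarrow> expansive f)
    \<and> (\<forall>s. \<bar>s\<bar> = 1 \<longrightarrow> (0 < poly g s \<longleftrightarrow> 0 < poly f s))"
  using assms
proof (induction n arbitrary: f)
  case 0
  then show ?case
    by auto
next
  case (Suc n)
  let ?N = "Suc (n + d)" and ?h = "schur_transform (Suc (n + d)) f"
  have deg: "degree f \<le> ?N"
    using Suc.prems(1) by simp
  have "(\<exists>m. Suc n = 1 + 2 * m) \<or> (\<exists>m. Suc n = 2 + 2 * m)"
    by presburger
  then have "schur_cohn_pos f ?N 1 \<or> schur_cohn_pos f ?N 2"
    using Suc.prems(3) by auto
  then have less: "\<bar>coeff f ?N\<bar> < coeff f 0"
    using deg Suc.prems(2) by (intro abs_coeff_less_if_schur_cohn_pos) auto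
  have "degree ?h \<le> n + d"
    using degree_schur_transform[OF deg] by simp
  moreover have "0 < coeff ?h 0"
    using deg less by (intro coeff_0_schur_transform_pos) auto
  moreover have "schur_cohn_pos ?h (n + d) k" if "n = k + 2 * m" for k m
    unfolding schur_cohn_pos_schur_transform_iff[OF deg less]
    using Suc.prems(3) that by simp
  ultimately obtain g where "degree g \<le> d" "0 < coeff g 0" "expansive g \<longleftrightarrow> expansive ?h"
    "\<forall>s. \<bar>s\<bar> = 1 \<longrightarrow> (0 < poly g s \<longleftrightarrow> 0 < poly ?h s)"
    using Suc.IH[of ?h] by blast
  moreover have "expansive ?h \<longleftrightarrow> expansive f"
    using deg less by (intro expansive_schur_transform_iff) auto
  ultimately show ?case
    using poly_schur_transform_pos_iff[OF deg less] by auto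
qed

lemma expansive_if_schur_cohn_pos_same_parity:
  assumes "degree f \<le> n" and "0 < coeff f 0"
    and "\<forall>k\<ge>1. (\<exists>m. n = k + 2 * m) \<longrightarrow> schur_cohn_pos f n k"
  shows "expansive f"
proof -
  obtain g where "degree g \<le> 0" "0 < coeff g 0" "expansive g \<longleftrightarrow> expansive f"
    using schur_reduction[of f n 0] assms by auto
  then show ?thesis
    using expansive_if_degree_le_1[of g] by (simp add: coeff_eq_0)
qed

lemma expansive_if_schur_cohn_pos_other_parity:
  assumes "degree f \<le> n" and "1 \<le> n" and "0 < coeff f 0"
    and "\<forall>k\<ge>1. (\<exists>m. n - 1 = k + 2 * m) \<longrightarrow> schur_cohn_pos f n k"
    and "0 < poly f 1" and "0 < poly f (-1)"
  shows "expansive f"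
proof -
  obtain g where g: "degree g \<le> 1" "expansive g \<longleftrightarrow> expansive f"
      "0 < poly g 1" "0 < poly g (-1)"
    using schur_reduction[of f "n - 1" 1] assms by auto
  have "\<bar>coeff g 1\<bar> < \<bar>coeff g 0\<bar>"
    using g(3,4) by (subst (asm) (1 2) degree_le_1_conv_pCons[OF g(1)]) simp
  then show ?thesis
    using expansive_if_degree_le_1 g(1,2) by blast
qed

theorem theorem3p2:
  fixes f :: "real poly" and n :: nat
  assumes "degree f = n" and "n \<ge> 1" and "coeff f 0 > 0"
  shows "(expansive f \<longleftrightarrow>
           (\<forall>k\<in>{1..n}. D_plus k f > 0 \<and> D_minus k f > 0))
    \<and> (expansive f \<longleftrightarrow>
           (\<forall>k\<in>{1..n-1}. D_plus k f > 0 \<and> D_minus k f > 0)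
           \<and> poly f 1 > 0 \<and> poly f (-1) > 0)
    \<and> (expansive f \<longleftrightarrow>
           (\<forall>k\<ge>1. (\<exists>m. n = k + 2 * m) \<longrightarrow> D_plus k f > 0 \<and> D_minus k f > 0))
    \<and> (expansive f \<longleftrightarrow>
           (\<forall>k\<ge>1. (\<exists>m. n - 1 = k + 2 * m) \<longrightarrow> D_plus k f > 0 \<and> D_minus k f > 0)
           \<and> poly f 1 > 0 \<and> poly f (-1) > 0)"
proof -
  have all: "schur_cohn_pos f n k" if "expansive f" "k \<le> n" for k
    using schur_cohn_pos_if_expansive that assms by simp
  have endpoints: "0 < poly f 1 \<and> 0 < poly f (-1)" if "expansive f"
    using poly_pos_if_expansive that assms(3) by simp
  have same_parity: "expansive f" if "\<forall>k\<ge>1. (\<exists>m. n = k + 2 * m) \<longrightarrow> schur_cohn_pos f n k"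
    using expansive_if_schur_cohn_pos_same_parity that assms by blast
  have other_parity: "expansive f"
    if "\<forall>k\<ge>1. (\<exists>m. n - 1 = k + 2 * m) \<longrightarrow> schur_cohn_pos f n k" "0 < poly f 1" "0 < poly f (-1)"
    using expansive_if_schur_cohn_pos_other_parity that assms by blast
  show ?thesis
    unfolding D_pos_iff_schur_cohn_pos assms(1)
    by (intro conjI iffI same_parity other_parity) (use all endpoints in auto)
qed

end
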